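(* Let $p$ be any odd prime. For all signatures $\sigma=(\sigma_1,\ldots,\sigma_{N})\in\{1,-1\}^N$ of length $N=p-1$, $$C(\sigma)\equiv\sigma_1\cdots\sigma_{p-1}\pmod p.$$ In particular, $C(\sigma)$ only takes the values $\pm1\pmod p$. Likewise, for all signatures $\sigma=(\sigma_1,\ldots,\sigma_p)\in\{1,-1\}^p$ of length $N=p$, $$2\,C(\sigma)\equiv(\sigma_1+\sigma_p)\,\sigma_1\cdots\sigma_p\pmod p,$$ and therefore $C(\sigma)$ only takes the values $0,\pm1\pmod p$.
   Context: For $N\ge1$ and a permutation $\pi$ of $\{1,\ldots,N+1\}$, the up-down signature of $\pi$ is $\sigma=(\sigma_1,\ldots,\sigma_N)\in\{1,-1\}^N$ with $\sigma_i=\mathrm{sign}(\pi(i+1)-\pi(i))$. For a signature $\sigma\in\{1,-1\}^N$ of length $N$, $C(\sigma)$ denotes the number of permutations of $\{1,\ldots,N+1\}$ with up-down signature $\sigma$. *)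

theory Defs
  imports
    "HOL-Library.FuncSet"
    "HOL-Combinatorics.Permutations"
    "HOL-Number_Theory.Cong"
    "HOL-Computational_Algebra.Primes"
begin

text \<open>
  A signature of length \<open>N\<close> is an extensional function on \<open>{1..N}\<close>, so that two signatures of
  the same length are equal iff they agree on \<open>{1..N}\<close>. The function does not determine its
  length, hence \<open>N\<close> is an explicit argument throughout.
\<close>

definition signatures :: "nat \<Rightarrow> (nat \<Rightarrow> int) set" where
  "signatures N = {1..N} \<rightarrow>\<^sub>E {1, -1}"

definition up_down_signature :: "nat \<Rightarrow> (nat \<Rightarrow> nat) \<Rightarrow> nat \<Rightarrow> int" where
  "up_down_signature N \<pi> = (\<lambda>i\<in>{1..N}. sgn (int (\<pi> (i + 1)) - int (\<pi> i)))"

definition signature_count :: "nat \<Rightarrow> (nat \<Rightarrow> int) \<Rightarrow> nat" where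
  "signature_count N \<sigma> = card {\<pi>. \<pi> permutes {1..N+1} \<and> up_down_signature N \<pi> = \<sigma>}"

end

theory Submission
  imports Defs "HOL-Library.Infinite_Set"
begin

text \<open>
  The idea is to compare a signature with the one obtained by reversing its \<open>i\<close>-th sign.
  Taken together, the permutations with either signature are those whose \<open>i\<close>-th sign is free.
  Such a permutation of \<open>{1..N+1}\<close> is built by choosing the set of its first \<open>i\<close> values and then
  arranging that set and its complement independently with the prescribed signs. Hence
  \<open>C(u, 1, v) + C(u, -1, v) = (N + 1 choose i) * C(u) * C(v)\<close> (lemma \<open>count_flip\<close>).

  If \<open>N + 1 = p\<close>, the binomial coefficient vanishes modulo \<open>p\<close>, so reversing a sign negates
  \<open>C\<close>, exactly as it negates the product of the signs. If \<open>N + 1 = p + 1\<close>, it vanishes for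
  \<open>1 < i < p\<close> and is \<open>1\<close> modulo \<open>p\<close> for \<open>i = 1\<close> and \<open>i = p\<close>; in these two cases the other factor
  has length \<open>p - 1\<close> and is known from the first part. In both cases \<open>C\<close> and the claimed
  expression obey the same flip relation, and they agree on the all-ones signature, whose only
  permutation is the identity. This determines them on all signatures
  (lemma \<open>sign_words_cong_by_flips\<close>).

  The counting is carried out with lists: a permutation becomes the list of its values,
  and a signature becomes the list of its signs.
\<close>

section \<open>Arrangements of a finite set with prescribed signs\<close>

text \<open>The signs of the differences of consecutive entries.\<close>

fun signs :: "nat list \<Rightarrow> int list" where
  "signs (x # y # zs) = sgn (int y - int x) # signs (y # zs)"
| "signs _ = []"

lemma length_signs: "length (signs xs) = length xs - 1"
  by (induction xs rule: signs.induct) auto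

lemma nth_signs:
  "Suc i < length xs \<Longrightarrow> signs xs ! i = sgn (int (xs ! Suc i) - int (xs ! i))"
proof (induction xs arbitrary: i rule: signs.induct)
  case (1 x y zs)
  then show ?case by (cases i) auto
qed auto

lemma signs_append:
  assumes "xs \<noteq> []" "ys \<noteq> []"
  shows "signs (xs @ ys) = signs xs @ sgn (int (hd ys) - int (last xs)) # signs ys"
  using assms
proof (induction xs rule: signs.induct)
  case ("2_2" x)
  then show ?case by (cases ys) auto
qed auto

lemma signs_map_strict_mono_on:
  assumes "strict_mono_on A h" "set xs \<subseteq> A"
  shows "signs (map h xs) = signs xs"
  using assms(2)
proof (induction xs rule: signs.induct)
  case (1 x y zs)
  then have "sgn (int (h y) - int (h x)) = sgn (int y - int x)"
    using strict_mono_onD[OF assms(1), of x y] strict_mono_onD[OF assms(1), of y x]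
    by (cases x y rule: linorder_cases) auto
  with 1 show ?case by auto
qed auto

lemma signs_eq_replicate_one_iff:
  "signs xs = replicate (length xs - 1) 1 \<longleftrightarrow> sorted_wrt (<) xs"
proof (induction xs rule: signs.induct)
  case (1 x y zs)
  have "sgn (int y - int x) = 1 \<longleftrightarrow> x < y"
    by (auto simp: sgn_if)
  with 1 show ?case by (auto intro: less_trans)
qed auto

text \<open>
  The orderings of the elements of \<open>A\<close> whose consecutive differences have the signs \<open>w\<close>.
  For \<open>A = {1..N+1}\<close> they are the permutations with signature \<open>w\<close> in one-line notation; other
  sets occur as the two parts of a permutation that is cut at the position of a free sign.
\<close>

definition arrangements :: "nat set \<Rightarrow> int list \<Rightarrow> nat list set" where
  "arrangements A w = {xs. distinct xs \<and> set xs = A \<and> signs xs = w}"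

lemma length_arrangement: "xs \<in> arrangements A w \<Longrightarrow> length xs = card A"
  by (auto simp: arrangements_def distinct_card)

lemma finite_arrangements:
  assumes "finite A"
  shows "finite (arrangements A w)"
proof (rule finite_subset)
  show "arrangements A w \<subseteq> {xs. set xs \<subseteq> A \<and> length xs = card A}"
    using length_arrangement by (auto simp: arrangements_def)
qed (use assms in \<open>rule finite_lists_length_eq\<close>)

text \<open>
  Relabelling along the increasing bijection onto an initial segment preserves signs, so the
  number of arrangements depends only on the size of \<open>A\<close>.
\<close>

lemma card_arrangements_lessThan:
  assumes "finite A"
  shows "card (arrangements A w) = card (arrangements {..<card A} w)"
proof -
  obtain h where bij: "bij_betw h {..<card A} A" and mono: "strict_mono_on {..<card A} h"
    using ex_bij_betw_strict_mono_card[OF assms] by blast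
  have inj: "inj_on h {..<card A}" and img: "h ` {..<card A} = A"
    using bij by (auto simp: bij_betw_def)
  have "bij_betw (map h) (arrangements {..<card A} w) (arrangements A w)"
    unfolding bij_betw_def
  proof
    show "inj_on (map h) (arrangements {..<card A} w)"
    proof (rule inj_onI)
      fix xs ys
      assume "xs \<in> arrangements {..<card A} w" "ys \<in> arrangements {..<card A} w"
        and "map h xs = map h ys"
      then show "xs = ys"
        using inj by (auto simp: arrangements_def intro: map_inj_on)
    qed
    show "map h ` arrangements {..<card A} w = arrangements A w"
    proof
      show "map h ` arrangements {..<card A} w \<subseteq> arrangements A w"
        using inj img signs_map_strict_mono_on[OF mono]
        by (auto simp: arrangements_def distinct_map)
      show "arrangements A w \<subseteq> map h ` arrangements {..<card A} w"
      proof
        fix ys assume ys: "ys \<in> arrangements A w"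
        then have "set ys \<subseteq> h ` {..<card A}"
          by (auto simp: arrangements_def img)
        then have "ys \<in> lists (h ` {..<card A})"
          by auto
        then obtain xs where xs: "ys = map h xs" "set xs \<subseteq> {..<card A}"
          by (auto simp: lists_image)
        have "h ` set xs = h ` {..<card A}"
          using ys xs(1) img by (auto simp: arrangements_def)
        then have "set xs = {..<card A}"
          using inj xs(2) inj_on_image_eq_iff by blast
        then have "xs \<in> arrangements {..<card A} w"
          using ys xs signs_map_strict_mono_on[OF mono xs(2)]
          by (auto simp: arrangements_def distinct_map)
        with xs(1) show "ys \<in> map h ` arrangements {..<card A} w"
          by blast
      qed
    qed
  qed
  then show ?thesis
    using bij_betw_same_card by metis
qed

text \<open>
  The number of permutations with a given signature. Any ground set with \<open>length w + 1\<close>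
  elements gives the same number.
\<close>

definition word_count :: "int list \<Rightarrow> nat" where
  "word_count w = card (arrangements {1..length w + 1} w)"

lemma card_arrangements:
  assumes "finite A" "card A = length w + 1"
  shows "card (arrangements A w) = word_count w"
  using card_arrangements_lessThan[OF assms(1), of w]
    card_arrangements_lessThan[of "{1..length w + 1}" w] assms(2)
  by (simp add: word_count_def)

lemma word_count_replicate_one: "word_count (replicate n 1) = 1"
proof -
  have "arrangements {1..n + 1} (replicate n 1) = {sorted_list_of_set {1..n + 1}}"
  proof (intro equalityI subsetI)
    fix xs assume xs: "xs \<in> arrangements {1..n + 1} (replicate n 1)"
    then have "length xs = n + 1"
      using length_arrangement by fastforce
    then have "sorted_wrt (<) xs"
      using xs signs_eq_replicate_one_iff[of xs] by (simp add: arrangements_def)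
    then show "xs \<in> {sorted_list_of_set {1..n + 1}}"
      using xs sorted_list_of_set.idem_if_sorted_distinct[of xs] strict_sorted_iff[of xs]
      by (simp add: arrangements_def)
  next
    fix xs :: "nat list" assume "xs \<in> {sorted_list_of_set {1..n + 1}}"
    then show "xs \<in> arrangements {1..n + 1} (replicate n 1)"
      using signs_eq_replicate_one_iff[of "sorted_list_of_set {1..n + 1}"]
      by (simp add: arrangements_def)
  qed
  then show ?thesis
    by (simp add: word_count_def)
qed

section \<open>Reversing one sign\<close>

text \<open>
  An arrangement counted on the left splits uniquely as \<open>ys @ zs\<close>, where \<open>ys\<close> arranges some set
  \<open>S\<close> of \<open>length u + 1\<close> values with signs \<open>u\<close> and \<open>zs\<close> arranges the remaining values with signs
  \<open>v\<close>. The sign at the cut is arbitrary but nonzero, since \<open>S\<close> and its complement are disjoint.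
\<close>

lemma count_flip:
  "word_count (u @ 1 # v) + word_count (u @ (-1) # v) =
   (length u + length v + 2 choose (length u + 1)) * word_count u * word_count v"
proof -
  define k where "k = length u + 1"
  define X where "X = {1..length u + length v + 2}"
  define SS where "SS = {S. S \<subseteq> X \<and> card S = k}"
  define Q where "Q = (SIGMA S:SS. arrangements S u \<times> arrangements (X - S) v)"
  have finX: "finite X" and cardX: "card X = k + (length v + 1)"
    by (auto simp: X_def k_def)
  have finSS: "finite SS"
    unfolding SS_def by (rule finite_subset[of _ "Pow X"]) (use finX in auto)
  have finS: "finite S" if "S \<in> SS" for S
    using that finX finite_subset by (auto simp: SS_def)
  have X: "{1..length (u @ a # v) + 1} = X" for a
    by (auto simp: X_def)

  have "bij_betw (\<lambda>(S, ys, zs). ys @ zs) Q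
          (arrangements X (u @ 1 # v) \<union> arrangements X (u @ (-1) # v))"
    unfolding bij_betw_def
  proof
    show "inj_on (\<lambda>(S, ys, zs). ys @ zs) Q"
    proof (rule inj_onI, clarsimp simp: Q_def)
      fix S ys zs S' ys' zs'
      assume *: "S \<in> SS" "S' \<in> SS" "ys \<in> arrangements S u" "ys' \<in> arrangements S' u"
        and eq: "ys @ zs = ys' @ zs'"
      then have "length ys = length ys'"
        using length_arrangement by (auto simp: SS_def)
      with * eq show "S = S' \<and> ys = ys' \<and> zs = zs'"
        by (auto simp: arrangements_def)
    qed
    show "(\<lambda>(S, ys, zs). ys @ zs) ` Q =
            arrangements X (u @ 1 # v) \<union> arrangements X (u @ (-1) # v)"
    proof (intro equalityI subsetI)
      fix xs assume "xs \<in> (\<lambda>(S, ys, zs). ys @ zs) ` Q"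
      then obtain S ys zs where S: "S \<in> SS" and ys: "ys \<in> arrangements S u"
        and zs: "zs \<in> arrangements (X - S) v" and xs: "xs = ys @ zs"
        by (auto simp: Q_def)
      have SX: "S \<subseteq> X" "card S = k"
        using S by (auto simp: SS_def)
      then have "card (X - S) = length v + 1"
        using cardX finS[OF S] by (simp add: card_Diff_subset)
      then have ne: "ys \<noteq> []" "zs \<noteq> []"
        using length_arrangement[OF ys] length_arrangement[OF zs] SX(2) by (auto simp: k_def)
      have d: "distinct xs" "set xs = X"
        using ys zs xs SX(1) by (auto simp: arrangements_def)
      have "hd zs \<in> X - S" "last ys \<in> S"
        using ne ys zs hd_in_set last_in_set unfolding arrangements_def by blast+
      then have "hd zs \<noteq> last ys"
        by auto
      then have "sgn (int (hd zs) - int (last ys)) \<in> {1, -1}"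
        by (auto simp: sgn_if)
      then show "xs \<in> arrangements X (u @ 1 # v) \<union> arrangements X (u @ (-1) # v)"
        using signs_append[OF ne] ys zs d xs by (auto simp: arrangements_def)
    next
      fix xs assume "xs \<in> arrangements X (u @ 1 # v) \<union> arrangements X (u @ (-1) # v)"
      then obtain a where a: "xs \<in> arrangements X (u @ a # v)"
        by auto
      then have len: "length xs = k + (length v + 1)"
        using length_arrangement cardX by simp
      define ys zs where "ys = take k xs" and "zs = drop k xs"
      have xs: "xs = ys @ zs" and lys: "length ys = k" and lzs: "length zs = length v + 1"
        using len by (auto simp: ys_def zs_def)
      have ne: "ys \<noteq> []" "zs \<noteq> []"
        using lys lzs by (auto simp: k_def)
      have "signs ys @ sgn (int (hd zs) - int (last ys)) # signs zs = u @ a # v"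
        using a xs signs_append[OF ne] by (auto simp: arrangements_def)
      moreover have "length (signs ys) = length u"
        using lys by (simp add: length_signs k_def)
      ultimately have s: "signs ys = u" "signs zs = v"
        by auto
      have d: "distinct ys" "distinct zs" "set ys \<inter> set zs = {}" "set ys \<union> set zs = X"
        using a xs by (auto simp: arrangements_def)
      have "card (set ys) = k"
        using d(1) lys distinct_card by metis
      then have "(set ys, ys, zs) \<in> Q"
        using s d by (auto simp: Q_def SS_def arrangements_def)
      then show "xs \<in> (\<lambda>(S, ys, zs). ys @ zs) ` Q"
        using xs by force
    qed
  qed
  then have "card Q = card (arrangements X (u @ 1 # v) \<union> arrangements X (u @ (-1) # v))"
    by (rule bij_betw_same_card)
  also have "\<dots> = card (arrangements X (u @ 1 # v)) + card (arrangements X (u @ (-1) # v))"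
    by (rule card_Un_disjoint) (use finX in \<open>auto simp: finite_arrangements\<close>,
        auto simp: arrangements_def)
  also have "\<dots> = word_count (u @ 1 # v) + word_count (u @ (-1) # v)"
    using X by (simp add: word_count_def)
  finally have 1: "word_count (u @ 1 # v) + word_count (u @ (-1) # v) = card Q" ..

  have "card Q = (\<Sum>S\<in>SS. card (arrangements S u \<times> arrangements (X - S) v))"
    unfolding Q_def
    by (rule card_SigmaI) (use finSS finS finX in \<open>auto simp: finite_arrangements\<close>)
  also have "\<dots> = (\<Sum>S\<in>SS. word_count u * word_count v)"
  proof (rule sum.cong[OF refl])
    fix S assume S: "S \<in> SS"
    then have "card S = length u + 1" "card (X - S) = length v + 1"
      using cardX finS[OF S] by (auto simp: SS_def card_Diff_subset k_def)
    then show "card (arrangements S u \<times> arrangements (X - S) v) = word_count u * word_count v"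
      using finS[OF S] finX by (simp add: card_cartesian_product card_arrangements)
  qed
  also have "\<dots> = card SS * (word_count u * word_count v)"
    by simp
  also have "card SS = (length u + length v + 2 choose (length u + 1))"
    using n_subsets[OF finX, of k] cardX by (simp add: SS_def k_def add_ac)
  finally show ?thesis
    using 1 by (simp add: mult.assoc)
qed

text \<open>
  A function on sign words of length \<open>n\<close> is determined modulo \<open>m\<close> by its value at the
  all-ones word together with the sums of its values over pairs of words differing in one place.
\<close>

lemma sign_words_cong_by_flips:
  fixes f g :: "int list \<Rightarrow> int"
  assumes base: "[f (replicate n 1) = g (replicate n 1)] (mod m)"
    and flip: "\<And>u v. \<lbrakk>set u \<subseteq> {1, -1}; set v \<subseteq> {1, -1}; length u + length v + 1 = n\<rbrakk> \<Longrightarrow>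
      [f (u @ 1 # v) + f (u @ (-1) # v) = g (u @ 1 # v) + g (u @ (-1) # v)] (mod m)"
    and w: "set w \<subseteq> {1, -1}" "length w = n"
  shows "[f w = g w] (mod m)"
proof -
  have "[f (replicate k 1 @ v) = g (replicate k 1 @ v)] (mod m)"
    if "set v \<subseteq> {1, -1}" "k + length v = n" for k v
    using that
  proof (induction v arbitrary: k)
    case Nil
    then show ?case using base by simp
  next
    case (Cons a v)
    have pos: "[f (replicate k 1 @ 1 # v) = g (replicate k 1 @ 1 # v)] (mod m)"
      using Cons.IH[of "Suc k"] Cons.prems by (simp add: replicate_app_Cons_same)
    show ?case
    proof (cases "a = 1")
      case True
      with pos show ?thesis by simp
    next
      case False
      with Cons.prems have a: "a = -1" by simp
      have "[f (replicate k 1 @ 1 # v) + f (replicate k 1 @ (-1) # v) =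
             g (replicate k 1 @ 1 # v) + g (replicate k 1 @ (-1) # v)] (mod m)"
        by (rule flip) (use Cons.prems in auto)
      from cong_diff[OF this pos] a show ?thesis by simp
    qed
  qed
  from this[of w 0] w show ?thesis by simp
qed

section \<open>Counts modulo a prime\<close>

lemma prod_list_signs_cases:
  "set w \<subseteq> {1, -1 :: int} \<Longrightarrow> prod_list w = 1 \<or> prod_list w = -1"
  by (induction w) auto

lemma word_count_cong_prime_minus_one:
  assumes p: "prime p"
    and w: "set w \<subseteq> {1, -1}" "length w = p - 1"
  shows "[int (word_count w) = prod_list w] (mod int p)"
proof (rule sign_words_cong_by_flips[OF _ _ w])
  show "[int (word_count (replicate (p - 1) 1)) = prod_list (replicate (p - 1) 1)] (mod int p)"
    by (simp only: word_count_replicate_one) (simp add: prod_list_replicate)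
next
  fix u v :: "int list"
  assume len: "length u + length v + 1 = p - 1"
  then have "p dvd (length u + length v + 2 choose (length u + 1))"
    using dvd_choose_prime[where k = "length u + 1" and n = p] p by simp
  then have "[word_count (u @ 1 # v) + word_count (u @ (-1) # v) = 0] (mod p)"
    unfolding count_flip by (simp add: cong_0_iff)
  then have "[int (word_count (u @ 1 # v) + word_count (u @ (-1) # v)) = int 0] (mod int p)"
    by (simp only: cong_int_iff)
  then show "[int (word_count (u @ 1 # v)) + int (word_count (u @ (-1) # v)) =
      prod_list (u @ 1 # v) + prod_list (u @ (-1) # v)] (mod int p)"
    by simp
qed

lemma two_word_count_cong_prime:
  assumes p: "prime p"
    and w: "set w \<subseteq> {1, -1}" "length w = p"
  shows "[2 * int (word_count w) = (hd w + last w) * prod_list w] (mod int p)"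
proof (rule sign_words_cong_by_flips[OF _ _ w])
  have "p > 0"
    using p by (simp add: prime_gt_0_nat)
  then show "[2 * int (word_count (replicate p 1)) =
      (hd (replicate p 1) + last (replicate p 1)) * prod_list (replicate p 1)] (mod int p)"
    by (simp only: word_count_replicate_one) (simp add: prod_list_replicate hd_replicate)
next
  fix u v :: "int list"
  assume uv: "set u \<subseteq> {1, -1}" "set v \<subseteq> {1, -1}" and len: "length u + length v + 1 = p"
  let ?c = "p + 1 choose (length u + 1)"
  have sum: "int (word_count (u @ 1 # v)) + int (word_count (u @ (-1) # v)) =
      int ?c * int (word_count u) * int (word_count v)"
  proof -
    have "length u + length v + 2 = p + 1" using len by simp
    then show ?thesis
      using arg_cong[OF count_flip[of u v], of int] by simp
  qed
  have p2: "p \<ge> 2"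
    using p by (rule prime_ge_2_nat)
  have one: "word_count [] = 1"
    using word_count_replicate_one[of 0] by simp
  \<comment> \<open>The reversed sign is the first one, the last one, or an inner one.\<close>
  consider "u = []" | "v = []" | "u \<noteq> []" "v \<noteq> []" by blast
  then have "[2 * (int (word_count (u @ 1 # v)) + int (word_count (u @ (-1) # v))) =
      (hd (u @ 1 # v) + last (u @ 1 # v)) * prod_list (u @ 1 # v) +
      (hd (u @ (-1) # v) + last (u @ (-1) # v)) * prod_list (u @ (-1) # v)] (mod int p)"
  proof cases
    case 1
    have c: "[int ?c = 1] (mod int p)"
      using 1 by (simp add: cong_iff_dvd_diff)
    have "[int (word_count v) = prod_list v] (mod int p)"
      using 1 len uv by (intro word_count_cong_prime_minus_one p) auto
    from cong_scalar_left[OF cong_mult[OF c this], of 2] show ?thesis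
      using 1 len p2 one unfolding sum by (auto simp: algebra_simps)
  next
    case 2
    have c: "[int ?c = 1] (mod int p)"
      using 2 len by (simp add: cong_iff_dvd_diff)
    have "[int (word_count u) = prod_list u] (mod int p)"
      using 2 len uv by (intro word_count_cong_prime_minus_one p) auto
    from cong_scalar_left[OF cong_mult[OF c this], of 2] show ?thesis
      using 2 len p2 one unfolding sum by (auto simp: hd_append algebra_simps)
  next
    case 3
    have "length u > 0" "length v > 0"
      using 3 by auto
    then have "p dvd (p choose (length u))" "p dvd (p choose (length u + 1))"
      using len p by (auto intro!: dvd_choose_prime)
    then have "p dvd ?c"
      by (simp del: binomial_Suc_n)
    then have c: "[int ?c = 0] (mod int p)"
      unfolding cong_0_iff by (simp only: int_dvd_int_iff)
    from cong_scalar_right[OF c, of "2 * int (word_count u) * int (word_count v)"]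
    have "[2 * (int ?c * int (word_count u) * int (word_count v)) = 0] (mod int p)"
      by (simp add: mult_ac)
    \<comment> \<open>An inner sign affects neither end, so the two terms on the right cancel.\<close>
    then show ?thesis
      using 3 unfolding sum by simp
  qed
  then show "[2 * int (word_count (u @ 1 # v)) + 2 * int (word_count (u @ (-1) # v)) =
      (hd (u @ 1 # v) + last (u @ 1 # v)) * prod_list (u @ 1 # v) +
      (hd (u @ (-1) # v) + last (u @ (-1) # v)) * prod_list (u @ (-1) # v)] (mod int p)"
    by (simp only: distrib_left)
qed

section \<open>From permutations to arrangements\<close>

lemma signs_map_interval_iff:
  assumes "\<sigma> \<in> signatures N"
  shows "signs (map \<pi> [1..<N + 2]) = map \<sigma> [1..<N + 1] \<longleftrightarrow> up_down_signature N \<pi> = \<sigma>"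
proof -
  have "signs (map \<pi> [1..<N + 2]) = map \<sigma> [1..<N + 1] \<longleftrightarrow>
      (\<forall>i<N. sgn (int (\<pi> (Suc i + 1)) - int (\<pi> (Suc i))) = \<sigma> (Suc i))"
    by (auto simp: list_eq_iff_nth_eq length_signs nth_signs simp del: upt_Suc)
  also have "\<dots> \<longleftrightarrow> (\<forall>i\<in>{1..N}. sgn (int (\<pi> (i + 1)) - int (\<pi> i)) = \<sigma> i)"
  proof (intro iffI ballI allI impI)
    fix i assume *: "\<forall>i<N. sgn (int (\<pi> (Suc i + 1)) - int (\<pi> (Suc i))) = \<sigma> (Suc i)"
      and "i \<in> {1..N}"
    then obtain j where "i = Suc j" "j < N" by (cases i) auto
    with * show "sgn (int (\<pi> (i + 1)) - int (\<pi> i)) = \<sigma> i" by simp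
  qed auto
  also have "\<dots> \<longleftrightarrow> up_down_signature N \<pi> = \<sigma>"
  proof
    assume "\<forall>i\<in>{1..N}. sgn (int (\<pi> (i + 1)) - int (\<pi> i)) = \<sigma> i"
    then show "up_down_signature N \<pi> = \<sigma>"
      using assms unfolding signatures_def up_down_signature_def
      by (intro ext) (auto simp: restrict_def PiE_def extensional_def)
  qed (auto simp: up_down_signature_def)
  finally show ?thesis .
qed

lemma signature_count_eq_word_count:
  assumes "\<sigma> \<in> signatures N"
  shows "signature_count N \<sigma> = word_count (map \<sigma> [1..<N + 1])"
proof -
  let ?P = "{\<pi>. \<pi> permutes {1..N+1} \<and> up_down_signature N \<pi> = \<sigma>}"
  let ?A = "arrangements {1..N+1} (map \<sigma> [1..<N + 1])"
  let ?F = "\<lambda>\<pi>. map \<pi> [1..<N + 2]"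
  have set: "set [1..<N + 2] = {1..N + 1}"
    by (auto simp del: upt_Suc)
  have "bij_betw ?F ?P ?A"
    unfolding bij_betw_def
  proof
    show "inj_on ?F ?P"
    proof (rule inj_onI, clarsimp simp del: upt_Suc)
      fix \<pi> \<rho> :: "nat \<Rightarrow> nat"
      assume per: "\<pi> permutes {Suc 0..Suc N}" "\<rho> permutes {Suc 0..Suc N}"
        and eq: "\<forall>x\<in>{Suc 0..<Suc (Suc N)}. \<pi> x = \<rho> x"
      show "\<pi> = \<rho>"
      proof
        fix x show "\<pi> x = \<rho> x"
          using per eq by (cases "x \<in> {Suc 0..Suc N}") (auto simp: permutes_not_in)
      qed
    qed
    show "?F ` ?P = ?A"
    proof (intro equalityI subsetI)
      fix xs assume "xs \<in> ?F ` ?P"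
      then obtain \<pi> where \<pi>: "\<pi> permutes {1..N+1}" "up_down_signature N \<pi> = \<sigma>"
        and xs: "xs = ?F \<pi>" by auto
      have "distinct xs"
        unfolding xs using permutes_inj[OF \<pi>(1)] inj_on_subset
        by (simp add: distinct_map del: upt_Suc) blast
      moreover have "set xs = {1..N+1}"
        unfolding xs set_map set by (rule permutes_image[OF \<pi>(1)])
      ultimately show "xs \<in> ?A"
        using signs_map_interval_iff[OF assms, of \<pi>] \<pi>(2) xs by (simp add: arrangements_def)
    next
      fix xs assume A: "xs \<in> ?A"
      then have d: "distinct xs" and s: "set xs = {1..N+1}"
        by (auto simp: arrangements_def)
      have len: "length xs = N + 1"
        using length_arrangement[OF A] by simp
      define \<pi> where "\<pi> i = (if i \<in> {1..N+1} then xs ! (i - 1) else i)" for i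
      have F: "?F \<pi> = xs"
        by (rule nth_equalityI) (auto simp: len \<pi>_def simp del: upt_Suc)
      have "\<pi> ` {1..N+1} = {1..N+1}"
        using s F set by (metis set_map)
      moreover have "inj_on \<pi> {1..N+1}"
        using d F set by (metis distinct_map)
      ultimately have "\<pi> permutes {1..N+1}"
        by (intro bij_imp_permutes) (auto simp: bij_betw_def \<pi>_def)
      moreover have "up_down_signature N \<pi> = \<sigma>"
        using signs_map_interval_iff[OF assms, of \<pi>] A F by (simp add: arrangements_def)
      ultimately show "xs \<in> ?F ` ?P"
        using F by blast
    qed
  qed
  then have "card ?P = card ?A"
    by (rule bij_betw_same_card)
  then show ?thesis
    by (simp add: signature_count_def word_count_def del: upt_Suc)
qed

theorem corollary2p7:
  fixes p :: nat
  assumes "prime p" and "odd p"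
  shows "(\<forall>\<sigma>\<in>signatures (p - 1).
            [int (signature_count (p - 1) \<sigma>) = (\<Prod>i=1..p-1. \<sigma> i)] (mod int p)) \<and>
         (\<forall>\<sigma>\<in>signatures (p - 1).
            [int (signature_count (p - 1) \<sigma>) = 1] (mod int p) \<or>
            [int (signature_count (p - 1) \<sigma>) = -1] (mod int p)) \<and>
         (\<forall>\<sigma>\<in>signatures p.
            [2 * int (signature_count p \<sigma>) = (\<sigma> 1 + \<sigma> p) * (\<Prod>i=1..p. \<sigma> i)] (mod int p)) \<and>
         (\<forall>\<sigma>\<in>signatures p.
            [int (signature_count p \<sigma>) = 0] (mod int p) \<or>
            [int (signature_count p \<sigma>) = 1] (mod int p) \<or>
            [int (signature_count p \<sigma>) = -1] (mod int p))"
proof -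
  have p2: "p \<ge> 2"
    using assms(1) by (rule prime_ge_2_nat)
  have word: "set (map \<sigma> [1..<N + 1]) \<subseteq> {1, -1}" "length (map \<sigma> [1..<N + 1]) = N"
      "prod_list (map \<sigma> [1..<N + 1]) = (\<Prod>i=1..N. \<sigma> i)" if "\<sigma> \<in> signatures N" for \<sigma> N
  proof -
    show "set (map \<sigma> [1..<N + 1]) \<subseteq> {1, -1}"
      using that by (auto simp: signatures_def PiE_def Pi_def simp del: upt_Suc)
    have "{1..<N + 1} = {1..N}" by auto
    then show "prod_list (map \<sigma> [1..<N + 1]) = (\<Prod>i=1..N. \<sigma> i)"
      using prod.distinct_set_conv_list[of "[1..<N + 1]" \<sigma>] by (simp del: upt_Suc)
  qed simp
  have sign: "(\<Prod>i=1..N. \<sigma> i) = 1 \<or> (\<Prod>i=1..N. \<sigma> i) = -1" if "\<sigma> \<in> signatures N" for \<sigma> N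
    using prod_list_signs_cases[OF word(1)[OF that]] word(3)[OF that] by simp
  have A: "[int (signature_count (p - 1) \<sigma>) = (\<Prod>i=1..p-1. \<sigma> i)] (mod int p)"
    if "\<sigma> \<in> signatures (p - 1)" for \<sigma>
    using word_count_cong_prime_minus_one[OF assms(1) word(1,2)[OF that]] word(3)[OF that]
    by (simp only: signature_count_eq_word_count[OF that])
  have B: "[2 * int (signature_count p \<sigma>) = (\<sigma> 1 + \<sigma> p) * (\<Prod>i=1..p. \<sigma> i)] (mod int p)"
    if "\<sigma> \<in> signatures p" for \<sigma>
  proof -
    have "hd (map \<sigma> [1..<p + 1]) = \<sigma> 1" "last (map \<sigma> [1..<p + 1]) = \<sigma> p"
      using p2 by (auto simp: hd_map last_map simp del: upt_Suc)
    then show ?thesis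
      using two_word_count_cong_prime[OF assms(1) word(1,2)[OF that]] word(3)[OF that]
      by (simp only: signature_count_eq_word_count[OF that])
  qed
  have "[int (signature_count p \<sigma>) = 0] (mod int p) \<or>
        [int (signature_count p \<sigma>) = 1] (mod int p) \<or>
        [int (signature_count p \<sigma>) = -1] (mod int p)" if \<sigma>: "\<sigma> \<in> signatures p" for \<sigma>
  proof -
    have cop: "coprime 2 (int p)"
      using assms(2) by simp
    have "\<sigma> 1 \<in> {1, -1}" "\<sigma> p \<in> {1, -1}"
      using \<sigma> p2 by (auto simp: signatures_def PiE_def Pi_def)
    then obtain c where c: "c \<in> {0, 1, -1}" "(\<sigma> 1 + \<sigma> p) * (\<Prod>i=1..p. \<sigma> i) = 2 * c"
      using sign[OF \<sigma>] by fastforce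
    then have "[2 * int (signature_count p \<sigma>) = 2 * c] (mod int p)"
      using B[OF \<sigma>] by simp
    then have "[int (signature_count p \<sigma>) = c] (mod int p)"
      using cong_mult_lcancel[OF cop] by blast
    with c(1) show ?thesis by auto
  qed
  moreover have "[int (signature_count (p - 1) \<sigma>) = 1] (mod int p) \<or>
      [int (signature_count (p - 1) \<sigma>) = -1] (mod int p)" if "\<sigma> \<in> signatures (p - 1)" for \<sigma>
    using A[OF that] sign[OF that] by auto
  ultimately show ?thesis
    using A B by blast
qed

end
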